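(* Let $\triangle ABC$ be a triangle and $P$ a given point. Let $\mathcal{E}_a^*,\mathcal{E}_b^*,\mathcal{E}_c^*$ be the triad of P-ellipses of $\triangle ABC$ with respect to $P$. Then the six vertices of $\mathcal{E}_a^*,\mathcal{E}_b^*,\mathcal{E}_c^*$ lie on a conic $\mathcal{Y}^*$.
   Context: Given a triangle $\triangle ABC$ and a point $P$, the P-ellipses $\mathcal{E}_a^*,\mathcal{E}_b^*,\mathcal{E}_c^*$ are the ellipses with foci on $(B,C)$, $(C,A)$, $(A,B)$, respectively, passing through $P$. The vertices of an ellipse are its two intersections with its focal axis (the line through the foci). *)

theory Defs
  imports "HOL-Analysis.Analysis"
begin

text \<open>
  The strict inequality excludes the degenerate locus \<open>dist X F + dist X G = dist F G\<close>,
  which is the segment between the foci.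
\<close>
definition ellipse_with_foci :: "real^2 \<Rightarrow> real^2 \<Rightarrow> (real^2) set \<Rightarrow> bool" where
  "ellipse_with_foci F G E \<longleftrightarrow> (\<exists>s. s > dist F G \<and> E = {X. dist X F + dist X G = s})"

definition P_ellipse :: "real^2 \<Rightarrow> real^2 \<Rightarrow> real^2 \<Rightarrow> (real^2) set \<Rightarrow> bool" where
  "P_ellipse P F G E \<longleftrightarrow> ellipse_with_foci F G E \<and> P \<in> E"

definition ellipse_vertices :: "real^2 \<Rightarrow> real^2 \<Rightarrow> (real^2) set \<Rightarrow> (real^2) set" where
  "ellipse_vertices F G E = E \<inter> affine hull {F, G}"

text \<open>
  Conics are zero sets of real polynomials of degree exactly two in the coordinates. Degenerate
  conics have to be included: every triangle admits points \<open>P\<close> in its interior for which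
  the six vertices of the ellipses lie, three by three, on two lines.
\<close>
definition is_conic :: "(real^2) set \<Rightarrow> bool" where
  "is_conic Y \<longleftrightarrow> (\<exists>a b c d e f :: real. (a, b, c) \<noteq> (0, 0, 0) \<and>
     Y = {X. a * (X$1)\<^sup>2 + b * X$1 * X$2 + c * (X$2)\<^sup>2 + d * X$1 + e * X$2 + f = 0})"

end

theory Submission imports Defs begin

text \<open>
  The two vertices on \<open>BC\<close> are symmetric about the midpoint of \<open>BC\<close>, so in barycentric
  coordinates \<open>(u, v, w)\<close> they are the two roots of \<open>v\<^sup>2 + w\<^sup>2 + p v w = 0\<close> for some \<open>p\<close>, and similarly
  with \<open>q\<close>, \<open>r\<close> on the other sides. Hence all six vertices lie on
  \<open>u\<^sup>2 + v\<^sup>2 + w\<^sup>2 + p v w + q w u + r u v = 0\<close>. The degree is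
  two because \<open>p > 2\<close>, so that the quadratic part does not vanish in the direction \<open>C - B\<close>.
\<close>

text \<open>The formula is twice the oriented area. With \<open>X\<close> in place of one vertex of
  \<open>A B C\<close>, it is the barycentric coordinate of \<open>X\<close> at that vertex times
  \<open>signed_area A B C\<close>, so barycentric equations become polynomial ones without
  division.\<close>

definition signed_area :: "real^2 \<Rightarrow> real^2 \<Rightarrow> real^2 \<Rightarrow> real" where
  "signed_area A B C = (B$1 - A$1) * (C$2 - A$2) - (C$1 - A$1) * (B$2 - A$2)"

lemma collinear_if_signed_area_zero:
  assumes "signed_area A B C = 0"
  shows "collinear {A, B, C}"
proof (cases "B = A")
  case False
  define u v where "u = B - A" and "v = C - A"
  have det: "u$1 * v$2 = v$1 * u$2"
    using assms by (simp add: signed_area_def u_def v_def)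
  have "u$1 \<noteq> 0 \<or> u$2 \<noteq> 0"
    using False by (auto simp: u_def vec_eq_iff forall_2)
  then have "\<exists>c. v = c *\<^sub>R u"
  proof
    assume "u$1 \<noteq> 0"
    with det have "v = (v$1 / u$1) *\<^sub>R u"
      by (simp add: vec_eq_iff forall_2 field_simps)
    then show ?thesis by blast
  next
    assume "u$2 \<noteq> 0"
    with det have "v = (v$2 / u$2) *\<^sub>R u"
      by (simp add: vec_eq_iff forall_2 field_simps)
    then show ?thesis by blast
  qed
  then have "collinear {0, u, v}"
    by (auto simp: collinear_lemma)
  \<comment> \<open>\<open>collinear_3\<close> takes the middle point as origin, hence
    \<open>A\<close> is moved there.\<close>
  then have "collinear {B, A, C}"
    by (simp add: collinear_3 u_def v_def)
  then show ?thesis by (simp add: insert_commute)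
qed simp

text \<open>On the focal axis the distances to \<open>F\<close> and \<open>G\<close> are
  \<open>dist F G\<close> times the absolute values of the opposite weights. A vertex therefore has
  a prescribed \<open>\<bar>\<alpha>\<bar> + \<bar>\<beta>\<bar>\<close>, and with
  \<open>\<alpha> + \<beta> = 1\<close> this determines both \<open>\<alpha> * \<beta>\<close> and
  the sum of squares.\<close>

lemma ellipse_vertices_barycentric:
  assumes "ellipse_with_foci F G E" and "F \<noteq> G"
  shows "\<exists>p>2. \<forall>X\<in>ellipse_vertices F G E.
      \<exists>\<alpha> \<beta>. X = \<alpha> *\<^sub>R F + \<beta> *\<^sub>R G \<and> \<alpha> + \<beta> = 1 \<and> \<alpha>\<^sup>2 + \<beta>\<^sup>2 + p * \<alpha> * \<beta> = 0"
proof -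
  from assms(1) obtain s where s: "s > dist F G" and E: "E = {X. dist X F + dist X G = s}"
    by (auto simp: ellipse_with_foci_def)
  define k where "k = s / dist F G"
  have k: "k > 1" using s assms(2) by (simp add: k_def)
  then have k2: "k\<^sup>2 > 1" by simp
  \<comment> \<open>Minus the ratio of the values \<open>(1 + k\<^sup>2) / 2\<close> and
    \<open>(1 - k\<^sup>2) / 4\<close> that the sum of squares and the product of the weights take
    at every vertex.\<close>
  define p where "p = 2 * (k\<^sup>2 + 1) / (k\<^sup>2 - 1)"
  have "p > 2" using k2 by (simp add: p_def field_simps)
  moreover have "\<exists>\<alpha> \<beta>. X = \<alpha> *\<^sub>R F + \<beta> *\<^sub>R G \<and> \<alpha> + \<beta> = 1 \<and> \<alpha>\<^sup>2 + \<beta>\<^sup>2 + p * \<alpha> * \<beta> = 0"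
    if X: "X \<in> ellipse_vertices F G E" for X
  proof -
    from X obtain \<alpha> \<beta> where X_eq: "X = \<alpha> *\<^sub>R F + \<beta> *\<^sub>R G" and sum: "\<alpha> + \<beta> = 1"
      by (auto simp: ellipse_vertices_def affine_hull_2)
    have \<alpha>: "\<alpha> = 1 - \<beta>" using sum by simp
    have "X - F = \<beta> *\<^sub>R (G - F)" "X - G = \<alpha> *\<^sub>R (F - G)"
      by (simp_all add: X_eq \<alpha> algebra_simps)
    then have "dist X F = \<bar>\<beta>\<bar> * dist F G" "dist X G = \<bar>\<alpha>\<bar> * dist F G"
      by (simp_all add: dist_norm norm_minus_commute)
    moreover have "dist X F + dist X G = s"
      using X by (simp add: ellipse_vertices_def E)
    ultimately have "\<bar>\<alpha>\<bar> + \<bar>\<beta>\<bar> = k"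
      using assms(2) by (simp add: k_def field_simps)
    \<comment> \<open>Weights of equal sign would give absolute values summing to 1, less than
      \<open>k\<close>. So the signs are opposite, and the sum of absolute values is the absolute
      difference.\<close>
    then have "\<bar>\<alpha> - \<beta>\<bar> = k" using sum k by linarith
    then have "(\<alpha> - \<beta>)\<^sup>2 = k\<^sup>2" by (metis power2_abs)
    moreover have "(\<alpha> + \<beta>)\<^sup>2 = 1" using sum by simp
    ultimately have "4 * (\<alpha> * \<beta>) = 1 - k\<^sup>2" "2 * (\<alpha>\<^sup>2 + \<beta>\<^sup>2) = 1 + k\<^sup>2"
      by (simp_all add: power2_eq_square algebra_simps)
    then have "\<alpha> * \<beta> = (1 - k\<^sup>2) / 4" "\<alpha>\<^sup>2 + \<beta>\<^sup>2 = (1 + k\<^sup>2) / 2"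
      by simp_all
    moreover have "(1 + k\<^sup>2) / 2 + p * ((1 - k\<^sup>2) / 4) = 0"
      using k2 by (simp add: p_def field_simps)
    ultimately have "\<alpha>\<^sup>2 + \<beta>\<^sup>2 + p * (\<alpha> * \<beta>) = 0"
      by metis
    then have "\<alpha>\<^sup>2 + \<beta>\<^sup>2 + p * \<alpha> * \<beta> = 0"
      by (simp add: mult.assoc)
    with X_eq sum show ?thesis by blast
  qed
  ultimately show ?thesis by blast
qed

text \<open>The three coordinates are affine in \<open>X\<close>, so substitution gives a polynomial
  of degree at most two; what remains is a direction in which its quadratic part is nonzero.\<close>

lemma is_conic_barycentric:
  assumes "signed_area A B C \<noteq> 0" and "p \<noteq> 2"
  shows "is_conic {X. let u = signed_area X B C; v = signed_area A X C; w = signed_area A B X in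
    u\<^sup>2 + v\<^sup>2 + w\<^sup>2 + p * v * w + q * w * u + r * u * v = 0}"
proof -
  define a1 b1 c1 where "a1 = B$2 - C$2" and "b1 = C$1 - B$1" and "c1 = B$1 * C$2 - C$1 * B$2"
  define a2 b2 c2 where "a2 = C$2 - A$2" and "b2 = A$1 - C$1" and "c2 = C$1 * A$2 - A$1 * C$2"
  define a3 b3 c3 where "a3 = A$2 - B$2" and "b3 = B$1 - A$1" and "c3 = A$1 * B$2 - B$1 * A$2"
  have lin: "signed_area X B C = a1 * X$1 + b1 * X$2 + c1"
    "signed_area A X C = a2 * X$1 + b2 * X$2 + c2"
    "signed_area A B X = a3 * X$1 + b3 * X$2 + c3" for X
    by (simp_all add: signed_area_def a1_def b1_def c1_def a2_def b2_def c2_def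
        a3_def b3_def c3_def algebra_simps)
  \<comment> \<open>Coefficients of the expanded equation in the Cartesian coordinates of
    \<open>X\<close>.\<close>
  define a where "a = a1\<^sup>2 + a2\<^sup>2 + a3\<^sup>2 + p * a2 * a3 + q * a3 * a1 + r * a1 * a2"
  define b where "b = 2 * a1 * b1 + 2 * a2 * b2 + 2 * a3 * b3 + p * (a2 * b3 + a3 * b2)
    + q * (a3 * b1 + a1 * b3) + r * (a1 * b2 + a2 * b1)"
  define c where "c = b1\<^sup>2 + b2\<^sup>2 + b3\<^sup>2 + p * b2 * b3 + q * b3 * b1 + r * b1 * b2"
  define d where "d = 2 * a1 * c1 + 2 * a2 * c2 + 2 * a3 * c3 + p * (a2 * c3 + a3 * c2)
    + q * (a3 * c1 + a1 * c3) + r * (a1 * c2 + a2 * c1)"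
  define e where "e = 2 * b1 * c1 + 2 * b2 * c2 + 2 * b3 * c3 + p * (b2 * c3 + b3 * c2)
    + q * (b3 * c1 + b1 * c3) + r * (b1 * c2 + b2 * c1)"
  define f where "f = c1\<^sup>2 + c2\<^sup>2 + c3\<^sup>2 + p * c2 * c3 + q * c3 * c1 + r * c1 * c2"
  have expand: "(a1 * x + b1 * y + c1)\<^sup>2 + (a2 * x + b2 * y + c2)\<^sup>2 + (a3 * x + b3 * y + c3)\<^sup>2
      + p * (a2 * x + b2 * y + c2) * (a3 * x + b3 * y + c3)
      + q * (a3 * x + b3 * y + c3) * (a1 * x + b1 * y + c1)
      + r * (a1 * x + b1 * y + c1) * (a2 * x + b2 * y + c2)
    = a * x\<^sup>2 + b * x * y + c * y\<^sup>2 + d * x + e * y + f" for x y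
    unfolding a_def b_def c_def d_def e_def f_def by algebra
  \<comment> \<open>Along \<open>C - B\<close> the first coordinate is constant, which removes the
    terms with \<open>q\<close> and \<open>r\<close>, while the other two change at opposite
    rates.\<close>
  define x y where "x = C$1 - B$1" and "y = C$2 - B$2"
  have dir: "a1 * x + b1 * y = 0" "a2 * x + b2 * y = - signed_area A B C"
    "a3 * x + b3 * y = signed_area A B C"
    by (simp_all add: signed_area_def x_def y_def a1_def b1_def a2_def b2_def
        a3_def b3_def algebra_simps)
  have "a * x\<^sup>2 + b * x * y + c * y\<^sup>2
    = (a1 * x + b1 * y)\<^sup>2 + (a2 * x + b2 * y)\<^sup>2 + (a3 * x + b3 * y)\<^sup>2
      + p * (a2 * x + b2 * y) * (a3 * x + b3 * y)
      + q * (a3 * x + b3 * y) * (a1 * x + b1 * y)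
      + r * (a1 * x + b1 * y) * (a2 * x + b2 * y)"
    unfolding a_def b_def c_def by algebra
  also have "\<dots> = (2 - p) * (signed_area A B C)\<^sup>2"
    unfolding dir by (simp add: power2_eq_square algebra_simps)
  also have "\<dots> \<noteq> 0" using assms by simp
  finally have "(a, b, c) \<noteq> (0, 0, 0)" by auto
  then show ?thesis
    unfolding is_conic_def Let_def lin expand by blast
qed

text \<open>Signed area is affine in each argument and vanishes when two arguments coincide.\<close>

lemma signed_area_side:
  assumes "\<alpha> + \<beta> = 1"
  shows "signed_area (\<alpha> *\<^sub>R B + \<beta> *\<^sub>R C) B C = 0"
    and "signed_area A (\<alpha> *\<^sub>R B + \<beta> *\<^sub>R C) C = \<alpha> * signed_area A B C"
    and "signed_area A B (\<alpha> *\<^sub>R B + \<beta> *\<^sub>R C) = \<beta> * signed_area A B C"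
proof -
  have \<alpha>: "\<alpha> = 1 - \<beta>" using assms by simp
  show "signed_area (\<alpha> *\<^sub>R B + \<beta> *\<^sub>R C) B C = 0"
    and "signed_area A (\<alpha> *\<^sub>R B + \<beta> *\<^sub>R C) C = \<alpha> * signed_area A B C"
    and "signed_area A B (\<alpha> *\<^sub>R B + \<beta> *\<^sub>R C) = \<beta> * signed_area A B C"
    by (simp_all add: signed_area_def \<alpha> algebra_simps)
qed

lemma signed_area_rotate: "signed_area A B C = signed_area C A B"
  by (simp add: signed_area_def algebra_simps)

text \<open>The relation between the weights is homogeneous, so it survives multiplying both by
  \<open>signed_area A B C\<close>. Cyclic renaming of the vertices carries this over to the other
  two sides.\<close>

lemma side_point_on_conic:
  assumes "\<alpha> + \<beta> = 1" and "\<alpha>\<^sup>2 + \<beta>\<^sup>2 + p * \<alpha> * \<beta> = 0" and "X = \<alpha> *\<^sub>R B + \<beta> *\<^sub>R C"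
  shows "signed_area X B C = 0 \<and> (signed_area A X C)\<^sup>2 + (signed_area A B X)\<^sup>2
      + p * signed_area A X C * signed_area A B X = 0"
proof -
  have "(\<alpha> * D)\<^sup>2 + (\<beta> * D)\<^sup>2 + p * (\<alpha> * D) * (\<beta> * D) = (\<alpha>\<^sup>2 + \<beta>\<^sup>2 + p * \<alpha> * \<beta>) * D\<^sup>2" for D
    by algebra
  then show ?thesis
    using assms by (simp add: signed_area_side)
qed

theorem theorem1:
  fixes A B C P :: "real^2" and Ea Eb Ec :: "(real^2) set"
  assumes "\<not> collinear {A, B, C}"
    and "P_ellipse P B C Ea"
    and "P_ellipse P C A Eb"
    and "P_ellipse P A B Ec"
  shows "\<exists>Y. is_conic Y \<and>
    ellipse_vertices B C Ea \<union> ellipse_vertices C A Eb \<union> ellipse_vertices A B Ec \<subseteq> Y"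
proof -
  have D: "signed_area A B C \<noteq> 0"
    using assms(1) collinear_if_signed_area_zero by blast
  have "A \<noteq> B" "B \<noteq> C" "C \<noteq> A"
    using D by (auto simp: signed_area_def)
  have foci: "ellipse_with_foci B C Ea" "ellipse_with_foci C A Eb" "ellipse_with_foci A B Ec"
    using assms by (simp_all add: P_ellipse_def)
  obtain p where "p > 2" and p: "\<forall>X\<in>ellipse_vertices B C Ea.
      \<exists>\<alpha> \<beta>. X = \<alpha> *\<^sub>R B + \<beta> *\<^sub>R C \<and> \<alpha> + \<beta> = 1 \<and> \<alpha>\<^sup>2 + \<beta>\<^sup>2 + p * \<alpha> * \<beta> = 0"
    using ellipse_vertices_barycentric[OF foci(1) \<open>B \<noteq> C\<close>] by blast
  obtain q where q: "\<forall>X\<in>ellipse_vertices C A Eb.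
      \<exists>\<alpha> \<beta>. X = \<alpha> *\<^sub>R C + \<beta> *\<^sub>R A \<and> \<alpha> + \<beta> = 1 \<and> \<alpha>\<^sup>2 + \<beta>\<^sup>2 + q * \<alpha> * \<beta> = 0"
    using ellipse_vertices_barycentric[OF foci(2) \<open>C \<noteq> A\<close>] by blast
  obtain r where r: "\<forall>X\<in>ellipse_vertices A B Ec.
      \<exists>\<alpha> \<beta>. X = \<alpha> *\<^sub>R A + \<beta> *\<^sub>R B \<and> \<alpha> + \<beta> = 1 \<and> \<alpha>\<^sup>2 + \<beta>\<^sup>2 + r * \<alpha> * \<beta> = 0"
    using ellipse_vertices_barycentric[OF foci(3) \<open>A \<noteq> B\<close>] by blast
  let ?Y = "{X. let u = signed_area X B C; v = signed_area A X C; w = signed_area A B X in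
    u\<^sup>2 + v\<^sup>2 + w\<^sup>2 + p * v * w + q * w * u + r * u * v = 0}"
  have "X \<in> ?Y" if "X \<in> ellipse_vertices B C Ea" for X
    using bspec[OF p that] side_point_on_conic[of _ _ p X B C A] by (auto simp: Let_def)
  moreover have "X \<in> ?Y" if "X \<in> ellipse_vertices C A Eb" for X
  proof -
    \<comment> \<open>After rotation these three areas are \<open>v\<close>, \<open>w\<close>,
      \<open>u\<close> of \<open>?Y\<close>: here \<open>v\<close> vanishes and only the terms in
      \<open>w\<close> and \<open>u\<close> remain.\<close>
    have "signed_area X C A = 0" "(signed_area B X A)\<^sup>2 + (signed_area B C X)\<^sup>2
        + q * signed_area B X A * signed_area B C X = 0"
      using bspec[OF q that] side_point_on_conic[of _ _ q X C A B] by blast+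
    then show ?thesis
      using signed_area_rotate[of X C A] signed_area_rotate[of B X A]
        signed_area_rotate[of B C X]
      by (simp add: Let_def)
  qed
  moreover have "X \<in> ?Y" if "X \<in> ellipse_vertices A B Ec" for X
  proof -
    \<comment> \<open>Here the areas rotate to \<open>w\<close>, \<open>u\<close>, \<open>v\<close>,
      and \<open>w\<close> vanishes.\<close>
    have "signed_area X A B = 0" "(signed_area C X B)\<^sup>2 + (signed_area C A X)\<^sup>2
        + r * signed_area C X B * signed_area C A X = 0"
      using bspec[OF r that] side_point_on_conic[of _ _ r X A B C] by blast+
    then show ?thesis
      using signed_area_rotate[of A B X] signed_area_rotate[of X B C]
        signed_area_rotate[of A X C]
      by (simp add: Let_def)
  qed
  moreover have "is_conic ?Y"
    using is_conic_barycentric[OF D] \<open>p > 2\<close> by simp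
  ultimately show ?thesis by blast
qed

end
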